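(* Let $D$ be an $n\times n$ unit spherical EDM of embedding dimension $r$ and let $1\le k<l\le n$. Let $(\tilde z^i)^T$ be the $i$th row of $\tilde Z$, where $\tilde Z=w$ if $r=n-1$ and $\tilde Z=[\,w\;\;Z\,]$ if $r\le n-2$. Assume that $\tilde z^k=c\,\tilde z^l\neq 0$, where $c$ is a nonzero scalar. Then $$T^{\leq}_{kl}=\begin{cases}[\,\theta_c,\ 0\,] & \text{if } c>0,\\ [\,0,\ \theta_c\,] & \text{if } c<0,\end{cases}\qquad\text{where } \theta_c=\frac{-4c}{\|s^k-c\,s^l\|^2}.$$
   Context: An $n\times n$ real matrix $D=(d_{ij})$ is a Euclidean distance matrix (EDM) if there are points $p^1,\dots,p^n$ (generating points) in some Euclidean space with $d_{ij}=\|p^i-p^j\|^2$ for all $i,j$; the dimension of their affine span is the embedding dimension $r$ of $D$. $D$ is spherical of radius $\rho$ if its generating points, taken in $\mathbb{R}^r$, lie on a sphere of radius $\rho$ in $\mathbb{R}^r$ (equivalently, there is a scalar $\beta$ with $\beta ee^T-D\succeq 0$, and the smallest such $\beta$ is $2\rho^2$; $D=0$ counts as spherical of radius $0$). A unit spherical EDM is a spherical EDM of radius $1$. $e$ is the all-ones vector in $\mathbb{R}^n$, $M^\dagger$ is the Moore-Penrose inverse, and $w=D^\dagger e$ (so $Dw=e$). If $r\le n-2$, a Gale matrix $Z$ of $D$ is an $n\times(n-r-1)$ matrix whose columns form a basis of $\{x\in\mathbb{R}^n: P^Tx=0,\ e^Tx=0\}$, where $P$ is the $n\times r$ matrix whose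 rows are generating points of $D$ in $\mathbb{R}^r$; $(z^i)^T$ denotes the $i$th row of $Z$. Let $J=I-ee^T/n$ and $B=-\tfrac12 JDJ=PP^T$ with $P$ of size $n\times r$ and full column rank. Put $S=P(P^TP)^{-1}$ and let $(s^i)^T$ be the $i$th row of $S$ (so $SS^T=B^\dagger$ and $(s^i)^Ts^j=B^\dagger_{ij}$). $E^{kl}$ is the $n\times n$ symmetric matrix with $1$'s in positions $kl$ and $lk$ and zeros elsewhere. $T^{\leq}_{kl}$ is the set of real $t$ such that $D+tE^{kl}$ is a spherical EDM of radius $\rho\le 1$. *)

theory Defs
  imports "HOL-Analysis.Analysis"
begin

definition generating_points :: "real^'n^'n \<Rightarrow> ('n \<Rightarrow> 'a::euclidean_space) \<Rightarrow> bool" where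
  "generating_points D p \<longleftrightarrow> (\<forall>i j. D $ i $ j = (norm (p i - p j))\<^sup>2)"

(* A configuration of n points spans an affine space of dimension at most n - 1, so quantifying
   over configurations in real^'n captures all configurations in arbitrary Euclidean spaces. *)

definition embedding_dim :: "real^'n^'n \<Rightarrow> nat" where
  "embedding_dim D =
     (THE r. \<exists>p :: 'n \<Rightarrow> real^'n. generating_points D p \<and> aff_dim (range p) = int r)"

(* r depends on the matrix, so R^r is realised as the r-dimensional affine hull of the generating
   points; a sphere in R^r is then a sphere whose centre lies in this hull.  In particular the
   zero matrix is spherical of radius 0 only. *)

definition spherical_edm :: "real^'n^'n \<Rightarrow> real \<Rightarrow> bool" where
  "spherical_edm D \<rho> \<longleftrightarrow>
     (\<exists>p :: 'n \<Rightarrow> real^'n. generating_points D p \<and>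
        (\<exists>a \<in> affine hull (range p). range p \<subseteq> sphere a \<rho>))"

definition moore_penrose :: "real^'n^'m \<Rightarrow> real^'m^'n" where
  "moore_penrose A = (THE X. A ** X ** A = A \<and> X ** A ** X = X \<and>
     transpose (A ** X) = A ** X \<and> transpose (X ** A) = X ** A)"

(* The Gale matrix has n - r - 1 columns, a number that may be 0 and depends on the matrix, so it
   is given by the list of its columns; col_list_row extracts a row from such a list. *)

definition gale_matrix :: "real^'n^'n \<Rightarrow> real^'r^'n \<Rightarrow> (real^'n) list \<Rightarrow> bool" where
  "gale_matrix D P Z \<longleftrightarrow>
     generating_points D (\<lambda>i. P $ i) \<and>
     length Z = CARD('n) - CARD('r) - 1 \<and>
     distinct Z \<and> independent (set Z) \<and>
     span (set Z) = {x. transpose P *v x = 0 \<and> vec 1 \<bullet> x = 0}"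

definition col_list_row :: "(real^'n) list \<Rightarrow> 'n \<Rightarrow> real list" where
  "col_list_row Z i = map (\<lambda>z. z $ i) Z"

definition centering_matrix :: "real^'n^'n" where
  "centering_matrix = mat 1 - (1 / real CARD('n)) *\<^sub>R (\<chi> i j. 1)"

definition E_matrix :: "'n \<Rightarrow> 'n \<Rightarrow> real^'n^'n" where
  "E_matrix k l = (\<chi> i j. if (i = k \<and> j = l) \<or> (i = l \<and> j = k) then 1 else 0)"

definition T_le :: "real^'n^'n \<Rightarrow> 'n \<Rightarrow> 'n \<Rightarrow> real set" where
  "T_le D k l = {t. \<exists>\<rho>\<le>1. spherical_edm (D + t *\<^sub>R E_matrix k l) \<rho>}"

end

theory Submission
  imports Defs
begin

text \<open>A symmetric matrix \<open>D'\<close> with zero diagonal is a spherical EDM of radius at most one iff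
  \<open>2 e e\<^sup>T - D'\<close> is positive semidefinite: factor \<open>e e\<^sup>T - D'/2\<close> as a Gram matrix of unit vectors
  and project the origin onto their affine hull. Let \<open>Y = e e\<^sup>T - D/2\<close>, the Gram matrix of points
  \<open>u\<^sub>i\<close> on the unit sphere. Its null space contains the columns of \<open>[w Z]\<close>, and the hypothesis
  makes \<open>v = e\<^sub>k - c e\<^sub>l\<close> orthogonal to them. Hence \<open>v = Y y\<close> with \<open>y = S S\<^sup>T v\<close>, and
  \<open>y\<^sup>T Y y = \<parallel>S\<^sup>T v\<parallel>\<^sup>2 =: m\<close>. Together with a null vector whose \<open>l\<close>-th entry is nonzero this
  reduces positive semidefiniteness of \<open>Y - (t/2) E\<^sup>k\<^sup>l\<close> to the scalar inequality
  \<open>t\<^sup>2 m \<le> -4 t c\<close>.\<close>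

section \<open>Symmetric matrices and the Moore--Penrose inverse\<close>

lemma inner_transpose_mult:
  fixes A :: "real^'n^'m"
  shows "x \<bullet> (transpose A *v y) = (A *v x) \<bullet> y"
  by (metis dot_lmul_matrix inner_commute transpose_matrix_vector)

lemma inner_mult_transpose:
  fixes A :: "real^'n^'m"
  shows "x \<bullet> (A *v y) = (transpose A *v x) \<bullet> y"
  by (metis dot_lmul_matrix transpose_matrix_vector)

lemma gram_eq_0_imp_eq_0:
  fixes A :: "real^'n^'m"
  assumes "transpose A *v (A *v x) = 0"
  shows "A *v x = 0"
  using inner_transpose_mult[of x A "A *v x"] assms by simp

text \<open>A vector \<open>z\<close> orthogonal to the range of \<open>transpose A ** A\<close>
  satisfies \<open>A *v z = 0\<close>, hence is orthogonal to \<open>transpose A *v y\<close>. A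
  subspace is its own double orthogonal complement.\<close>

lemma normal_equation_solvable:
  fixes A :: "real^'n^'m"
  shows "\<exists>x. transpose A *v (A *v x) = transpose A *v y"
proof -
  let ?V = "range (\<lambda>x. transpose A *v (A *v x))"
  have lin: "linear (\<lambda>x. transpose A *v (A *v x))"
    by (simp add: matrix_vector_mul_assoc)
  have V: "subspace ?V"
    by (rule linear_subspace_image[OF lin subspace_UNIV])
  have "transpose A *v y \<in> ?V\<^sup>\<bottom>\<^sup>\<bottom>"
    unfolding orthogonal_comp_def[of "?V\<^sup>\<bottom>"]
  proof clarify
    fix z assume z: "z \<in> ?V\<^sup>\<bottom>"
    have "z \<bullet> (transpose A *v (A *v z)) = 0"
      using z by (auto simp: orthogonal_comp_def orthogonal_def inner_commute)
    then have "A *v z = 0"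
      by (simp add: inner_transpose_mult del: transpose_matrix_vector)
    then show "orthogonal z (transpose A *v y)"
      by (simp add: orthogonal_def inner_transpose_mult del: transpose_matrix_vector)
  qed
  then show ?thesis
    using orthogonal_comp_self[OF V] by force
qed

lemma normal_equation_matrix_solvable:
  fixes A :: "real^'n^'m"
  obtains G where "transpose A ** A ** G = transpose A"
proof -
  obtain g where g: "\<And>y. transpose A *v (A *v g y) = transpose A *v y"
    using normal_equation_solvable by metis
  \<comment> \<open>\<open>g\<close> is only a choice function, so the matrix is assembled from its
    values on the standard basis.\<close>
  define G where "G = (\<chi> i j. g (axis j 1) $ i)"
  have "transpose A *v (A *v (G *v axis j 1)) = transpose A *v axis j 1" for j
  proof -
    have "G *v axis j 1 = g (axis j 1)"
      by (simp add: matrix_vector_mult_basis column_def G_def vec_eq_iff)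
    then show ?thesis by (simp only: g)
  qed
  then have "column j (transpose A ** A ** G) = column j (transpose A)" for j
    by (simp flip: matrix_vector_mult_basis matrix_vector_mul_assoc)
  then show ?thesis
    by (intro that[of G]) (simp add: vec_eq_iff column_def)
qed

text \<open>\<open>A ** G\<close> is the orthogonal projection onto the range of \<open>A\<close>:
  it coincides with the symmetric matrix \<open>transpose G ** transpose A ** A ** G\<close>, and
  the residual \<open>A ** G ** A - A\<close> is killed by the Gram kernel argument.\<close>

lemma normal_equation_projection:
  fixes A :: "real^'n^'m"
  assumes G: "transpose A ** A ** G = transpose A"
  shows "transpose (A ** G) = A ** G" "A ** G ** A = A"
proof -
  have *: "transpose (A ** G) = transpose G ** (transpose A ** A ** G)"
    by (simp only: G matrix_transpose_mul)
  have "A ** G = transpose (transpose G ** transpose A)"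
    by (simp only: matrix_transpose_mul transpose_transpose)
  also have "transpose G ** transpose A = transpose G ** (transpose A ** A ** G)"
    by (simp only: G)
  also have "transpose \<dots> = transpose G ** (transpose A ** A ** G)"
    by (simp only: matrix_transpose_mul transpose_transpose matrix_mul_assoc)
  finally show "transpose (A ** G) = A ** G"
    using * by (rule trans[OF _ sym, rotated])
  have "(A ** G ** A) *v x = A *v x" for x
  proof -
    have "transpose A *v (A *v ((G ** A) *v x - x)) = 0"
      by (simp add: matrix_vector_mult_diff_distrib matrix_vector_mul_assoc matrix_mul_assoc G)
    then have "A *v ((G ** A) *v x - x) = 0"
      by (rule gram_eq_0_imp_eq_0)
    then show ?thesis
      by (simp add: matrix_vector_mult_diff_distrib matrix_vector_mul_assoc matrix_mul_assoc)
  qed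
  then show "A ** G ** A = A" by (simp add: matrix_eq)
qed

text \<open>The normal equations for \<open>A\<close> and for its transpose give projections
  \<open>A ** G\<close> and \<open>H ** A\<close> onto the column and row space;
  \<open>H ** A ** G\<close> combines both.\<close>

lemma moore_penrose_ex:
  fixes A :: "real^'n^'m"
  shows "\<exists>X. A ** X ** A = A \<and> X ** A ** X = X \<and>
     transpose (A ** X) = A ** X \<and> transpose (X ** A) = X ** A"
proof -
  obtain G where G: "transpose A ** A ** G = transpose A"
    by (rule normal_equation_matrix_solvable)
  obtain K where K: "transpose (transpose A) ** transpose A ** K = transpose (transpose A)"
    by (rule normal_equation_matrix_solvable)
  define H where "H = transpose K"
  have AG: "transpose (A ** G) = A ** G" "A ** G ** A = A"
    using normal_equation_projection[OF G] .
  have "transpose (transpose A ** K) = H ** A"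
    by (simp add: H_def matrix_transpose_mul)
  then have HA: "transpose (H ** A) = H ** A"
    by (metis normal_equation_projection(1)[OF K] transpose_transpose)
  have "transpose (transpose A ** K ** transpose A) = A ** H ** A"
    by (simp add: H_def matrix_transpose_mul matrix_mul_assoc)
  then have AHA: "A ** H ** A = A"
    by (simp add: normal_equation_projection(2)[OF K])
  have AX: "A ** (H ** A ** G) = A ** G" by (simp add: matrix_mul_assoc AHA)
  have XA: "(H ** A ** G) ** A = H ** A"
    by (metis AG(2) matrix_mul_assoc)
  have XAX: "(H ** A ** G) ** A ** (H ** A ** G) = H ** A ** G"
  proof -
    have "H ** A ** (H ** A ** G) = H ** (A ** H ** A) ** G" by (simp only: matrix_mul_assoc)
    then show ?thesis unfolding XA by (simp only: AHA)
  qed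
  show ?thesis
    using XAX by (intro exI[of _ "H ** A ** G"] conjI) (simp_all only: AX XA AG HA)
qed

text \<open>\<open>A ** X\<close> and \<open>A ** Y\<close> are symmetric projections with the same
  range, hence equal; likewise \<open>X ** A\<close> and \<open>Y ** A\<close>. Then
  \<open>X = X ** A ** X = Y ** A ** Y = Y\<close>.\<close>

lemma moore_penrose_unique:
  fixes A :: "real^'n^'m"
  assumes X: "A ** X ** A = A" "X ** A ** X = X" "transpose (A ** X) = A ** X" "transpose (X ** A) = X ** A"
    and Y: "A ** Y ** A = A" "Y ** A ** Y = Y" "transpose (A ** Y) = A ** Y" "transpose (Y ** A) = Y ** A"
  shows "X = Y"
proof -
  have "A ** X = transpose ((A ** Y) ** (A ** X))"
    by (metis X(3) Y(1) matrix_mul_assoc)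
  also have "\<dots> = A ** Y"
    by (metis X(1,3) Y(3) matrix_mul_assoc matrix_transpose_mul)
  finally have 1: "A ** X = A ** Y" .
  have "X ** A = transpose ((X ** A) ** (Y ** A))"
    by (metis X(4) Y(1) matrix_mul_assoc)
  also have "\<dots> = Y ** A"
    by (metis X(1,4) Y(4) matrix_mul_assoc matrix_transpose_mul)
  finally have 2: "X ** A = Y ** A" .
  show ?thesis by (metis 1 2 X(2) Y(2) matrix_mul_assoc)
qed

lemma mult_moore_penrose_mult: "A ** moore_penrose A ** A = A"
  for A :: "real^'n^'m"
proof -
  have "\<exists>!X. A ** X ** A = A \<and> X ** A ** X = X \<and>
     transpose (A ** X) = A ** X \<and> transpose (X ** A) = X ** A"
    using moore_penrose_ex[of A] moore_penrose_unique[of A] by (simp add: Ex1_def) metis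
  from theI'[OF this] show ?thesis unfolding moore_penrose_def by blast
qed

text \<open>Used to obtain \<open>D *v w = 1\<close> once some solution of that system is
  exhibited.\<close>

lemma moore_penrose_solves:
  fixes A :: "real^'n^'m"
  assumes "A *v x = b"
  shows "A *v (moore_penrose A *v b) = b"
  by (metis assms matrix_vector_mul_assoc mult_moore_penrose_mult)

section \<open>Gram factorisation of positive semidefinite matrices\<close>

lemma symmetric_matrix_component:
  fixes M :: "'a^'n^'n"
  assumes "transpose M = M"
  shows "M $ i $ j = M $ j $ i"
proof -
  have "transpose M $ j $ i = M $ i $ j" by (simp add: transpose_def)
  then show ?thesis by (simp only: assms)
qed

lemma inner_symmetric_matrix:
  fixes M :: "real^'n^'n"
  assumes "transpose M = M"
  shows "x \<bullet> (M *v y) = y \<bullet> (M *v x)"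
  by (metis assms inner_commute inner_mult_transpose)

lemma quadratic_form_shift:
  fixes M :: "real^'n^'n"
  assumes "transpose M = M"
  shows "(x + s *\<^sub>R axis b 1) \<bullet> (M *v (x + s *\<^sub>R axis b 1))
    = x \<bullet> (M *v x) + 2 * s * (M *v x) $ b + s\<^sup>2 * M $ b $ b"
proof -
  have "x \<bullet> (M *v axis b 1) = (M *v x) $ b"
    by (subst inner_symmetric_matrix[OF assms]) (simp add: inner_axis')
  moreover have "axis b 1 \<bullet> (M *v axis b 1) = M $ b $ b"
    by (simp add: inner_axis' matrix_vector_mult_basis column_def)
  ultimately show ?thesis
    by (simp add: inner_add_left inner_add_right matrix_vector_right_distrib
        matrix_vector_mult_scaleR inner_axis' power2_eq_square algebra_simps)
qed

text \<open>Symmetric elimination: \<open>A\<close> contains all nonzero rows, and passing to the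
  Schur complement \<open>M'\<close> of a diagonal entry removes one index from it. If that entry is
  0, its row vanishes and division by zero makes \<open>M' = M\<close>.\<close>

lemma psd_sum_rank_one:
  fixes M :: "real^'n^'n"
  assumes "finite A" "transpose M = M" "\<And>i j. i \<notin> A \<Longrightarrow> M $ i $ j = 0"
    and "\<And>x. 0 \<le> x \<bullet> (M *v x)"
  shows "\<exists>f. \<forall>i j. M $ i $ j = (\<Sum>a\<in>A. f a i * f a j)"
  using assms
proof (induction A arbitrary: M rule: finite_induct)
  case empty
  then show ?case by simp
next
  case (insert b A)
  note psd = \<open>\<And>x. 0 \<le> x \<bullet> (M *v x)\<close>
  have sym: "M $ i $ j = M $ j $ i" for i j
    by (rule symmetric_matrix_component[OF insert.prems(1)])
  have shift: "0 \<le> x \<bullet> (M *v x) + 2 * s * (M *v x) $ b + s\<^sup>2 * M $ b $ b" for x s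
    using psd[of "x + s *\<^sub>R axis b 1"] by (simp only: quadratic_form_shift[OF insert.prems(1)])
  have Mbb: "0 \<le> M $ b $ b"
    using shift[of 0 1] by simp
  define M' where "M' = M - (\<chi> i j. M $ i $ b * M $ b $ j / M $ b $ b)"
  have M': "M' $ i $ j = M $ i $ j - M $ i $ b * M $ b $ j / M $ b $ b" for i j
    by (simp add: M'_def)
  have Mb0: "M $ b $ j = 0" if "M $ b $ b = 0" for j
  proof -
    define m where "m = (M *v axis j 1) $ b"
    define q where "q = axis j 1 \<bullet> (M *v axis j 1)"
    have "0 \<le> q + 2 * s * m" for s
      using shift[of "axis j 1" s] that by (simp add: m_def q_def)
    \<comment> \<open>With \<open>M $ b $ b = 0\<close> the form is affine in \<open>s\<close>; for
      \<open>m \<noteq> 0\<close> this \<open>s\<close> would give it the value -1.\<close>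
    from this[of "- (q + 1) / (2 * m)"] have "0 \<le> q - (q + 1)" if "m \<noteq> 0"
      using that by (simp add: field_simps)
    then have "m = 0" by fastforce
    then show ?thesis by (simp add: m_def matrix_vector_mult_basis column_def)
  qed
  have outside: "M' $ i $ j = 0" if "i \<notin> A" for i j
  proof (cases "i = b")
    case True
    then show ?thesis using Mb0 by (auto simp: M')
  next
    case False
    then show ?thesis using insert.prems(2)[of i] that by (simp add: M')
  qed
  have "transpose M' = M'"
    unfolding vec_eq_iff transpose_def vec_lambda_beta M'
    by (metis sym mult.commute)
  moreover have "0 \<le> x \<bullet> (M' *v x)" for x
  proof -
    have "x \<bullet> ((\<chi> i j. M $ i $ b * M $ b $ j / M $ b $ b) *v x)
        = (\<Sum>i\<in>UNIV. M $ i $ b * x $ i) * (\<Sum>j\<in>UNIV. M $ b $ j * x $ j) / M $ b $ b"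
      by (simp add: inner_vec_def matrix_vector_mult_def sum_product sum_distrib_left
          sum_divide_distrib ac_simps) (subst sum.swap, simp add: ac_simps)
    also have "(\<Sum>i\<in>UNIV. M $ i $ b * x $ i) = (M *v x) $ b"
      by (simp add: matrix_vector_mult_def sym[of _ b])
    also have "(\<Sum>j\<in>UNIV. M $ b $ j * x $ j) = (M *v x) $ b"
      by (simp add: matrix_vector_mult_def)
    finally have "x \<bullet> (M' *v x) = x \<bullet> (M *v x) - ((M *v x) $ b)\<^sup>2 / M $ b $ b"
      by (simp add: M'_def matrix_vector_mult_diff_rdistrib inner_diff_right power2_eq_square)
    \<comment> \<open>\<open>s = - m / d\<close> minimises the quadratic in \<open>s\<close> from
      \<open>shift\<close>; its minimum is the form of the Schur complement.\<close>
    moreover have "2 * (- m / d) * m + (- m / d)\<^sup>2 * d = - (m\<^sup>2 / d)" if "d \<noteq> 0" for m d :: real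
      using that by (simp add: field_simps power2_eq_square)
    ultimately show ?thesis
      using shift[of x "- (M *v x) $ b / M $ b $ b"] psd[of x]
      unfolding add.assoc by (cases "M $ b $ b = 0") (simp, metis uminus_add_conv_diff add.commute)
  qed
  ultimately obtain f where f: "\<And>i j. M' $ i $ j = (\<Sum>a\<in>A. f a i * f a j)"
    using insert.IH[of M'] outside by auto
  \<comment> \<open>The new vector restores the subtracted rank-one term, also when
    \<open>M $ b $ b = 0\<close>, where both are 0.\<close>
  define g where "g = f (b := \<lambda>i. M $ i $ b / sqrt (M $ b $ b))"
  have "(\<Sum>a\<in>A. g a i * g a j) = M' $ i $ j" for i j
    unfolding f g_def using insert.hyps(2) by (intro sum.cong) auto
  then have "M $ i $ j = (\<Sum>a\<in>insert b A. g a i * g a j)" for i j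
    using insert.hyps Mbb by (simp add: g_def M' sym[of j b])
  then show ?case by blast
qed

lemma psd_gram:
  fixes M :: "real^'n^'n"
  assumes "transpose M = M" and "\<And>x. 0 \<le> x \<bullet> (M *v x)"
  obtains p :: "'n \<Rightarrow> real^'n" where "\<And>i j. M $ i $ j = p i \<bullet> p j"
proof -
  have "\<exists>f. \<forall>i j. M $ i $ j = (\<Sum>a\<in>(UNIV :: 'n set). f a i * f a j)"
    by (rule psd_sum_rank_one[OF finite]) (simp_all add: assms)
  then obtain f where "\<forall>i j. M $ i $ j = (\<Sum>a\<in>(UNIV :: 'n set). f a i * f a j)" ..
  then show ?thesis
    by (intro that[of "\<lambda>i. \<chi> a. f a i"]) (simp add: inner_vec_def)
qed

section \<open>Spherical distance matrices of radius at most one\<close>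

text \<open>Acts as the transpose of a matrix with rows \<open>u i\<close>, but for points in any
  space; in an inner product space its kernel is the null space of the Gram matrix of
  \<open>u\<close>.\<close>

definition lin_comb :: "('n::finite \<Rightarrow> 'a::real_vector) \<Rightarrow> real^'n \<Rightarrow> 'a" where
  "lin_comb u x = (\<Sum>i\<in>UNIV. x $ i *\<^sub>R u i)"

lemma lin_comb_add: "lin_comb u (x + y) = lin_comb u x + lin_comb u y"
  by (simp add: lin_comb_def scaleR_add_left sum.distrib)

lemma lin_comb_scaleR: "lin_comb u (a *\<^sub>R x) = a *\<^sub>R lin_comb u x"
  by (simp add: lin_comb_def scaleR_right.sum)

lemma one_inner: "1 \<bullet> x = (\<Sum>i\<in>UNIV. x $ i)"
  for x :: "real^'n"
  by (simp add: inner_vec_def)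

lemma inner_mult_vec: "x \<bullet> (D *v y) = (\<Sum>i\<in>UNIV. \<Sum>j\<in>UNIV. x $ i * y $ j * D $ i $ j)"
  for D :: "real^'n^'m"
  by (simp add: inner_vec_def matrix_vector_mult_def sum_distrib_left ac_simps)

lemma inner_lin_comb:
  "lin_comb u x \<bullet> lin_comb u y = (\<Sum>i\<in>UNIV. \<Sum>j\<in>UNIV. x $ i * y $ j * (u i \<bullet> u j))"
  unfolding lin_comb_def inner_sum_left inner_sum_right
  by (subst sum.swap) (simp add: ac_simps)

text \<open>Polarisation of the squared distances. The norm terms vanish on centred vectors, and
  become a multiple of the all-ones form for points on a sphere about the origin.\<close>

lemma inner_edm_mult:
  fixes D :: "real^'n^'n"
  assumes "generating_points D p"
  shows "x \<bullet> (D *v y) = (1 \<bullet> y) * (\<Sum>i\<in>UNIV. x $ i * (norm (p i))\<^sup>2)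
    + (1 \<bullet> x) * (\<Sum>j\<in>UNIV. y $ j * (norm (p j))\<^sup>2) - 2 * (lin_comb p x \<bullet> lin_comb p y)"
proof -
  have D: "D $ i $ j = (norm (p i))\<^sup>2 + (norm (p j))\<^sup>2 - 2 * (p i \<bullet> p j)" for i j
    using assms unfolding generating_points_def
    by (simp add: power2_norm_eq_inner inner_diff_left inner_diff_right inner_commute)
  have "x \<bullet> (D *v y) = (\<Sum>i\<in>UNIV. \<Sum>j\<in>UNIV. (x $ i * (norm (p i))\<^sup>2) * y $ j)
      + (\<Sum>i\<in>UNIV. \<Sum>j\<in>UNIV. x $ i * (y $ j * (norm (p j))\<^sup>2))
      - 2 * (\<Sum>i\<in>UNIV. \<Sum>j\<in>UNIV. x $ i * y $ j * (p i \<bullet> p j))"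
    unfolding inner_mult_vec sum_distrib_left sum.distrib[symmetric] sum_subtractf[symmetric]
    by (intro sum.cong refl) (simp add: D algebra_simps)
  then show ?thesis
    by (simp add: inner_lin_comb one_inner mult.commute[of "sum (($) y) UNIV"] flip: sum_product)
qed

lemma inner_edm_mult_centered:
  fixes D :: "real^'n^'n"
  assumes "generating_points D p" "1 \<bullet> x = 0" "1 \<bullet> y = 0"
  shows "x \<bullet> (D *v y) = - 2 * (lin_comb p x \<bullet> lin_comb p y)"
  by (simp add: inner_edm_mult[OF assms(1)] assms(2,3))

lemma inner_edm_mult_sphere:
  fixes D :: "real^'n^'n"
  assumes "generating_points D p" and "\<And>i. norm (p i) = \<rho>"
  shows "x \<bullet> (D *v y) = 2 * \<rho>\<^sup>2 * (1 \<bullet> x) * (1 \<bullet> y) - 2 * (lin_comb p x \<bullet> lin_comb p y)"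
  by (simp add: inner_edm_mult[OF assms(1)] assms(2) one_inner algebra_simps flip: sum_distrib_right)

lemma generating_points_translate:
  "generating_points D (\<lambda>i. p i - a) \<longleftrightarrow> generating_points D p"
  by (simp add: generating_points_def)

text \<open>Combinations with coefficient sum 1 form an affine set containing every point. This
  gives the centre of the sphere barycentric coordinates.\<close>

lemma affine_hull_range_lin_comb:
  fixes p :: "'n::finite \<Rightarrow> 'a::real_vector"
  assumes "a \<in> affine hull range p"
  obtains x where "1 \<bullet> x = 1" "lin_comb p x = a"
proof -
  let ?A = "{lin_comb p x |x. 1 \<bullet> x = 1}"
  have "affine ?A"
    unfolding affine_def
  proof clarify
    fix x y :: "real^'n" and u v :: real
    assume "1 \<bullet> x = 1" "1 \<bullet> y = 1" "u + v = 1"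
    then show "\<exists>z. u *\<^sub>R lin_comb p x + v *\<^sub>R lin_comb p y = lin_comb p z \<and> 1 \<bullet> z = 1"
      by (intro exI[of _ "u *\<^sub>R x + v *\<^sub>R y"])
        (simp add: lin_comb_add lin_comb_scaleR inner_add_right)
  qed
  moreover have "range p \<subseteq> ?A"
  proof clarify
    fix i
    have "lin_comb p (axis i 1) = p i"
      by (simp add: lin_comb_def axis_def if_distrib[of "\<lambda>c. c *\<^sub>R _"] cong: if_cong)
    moreover have "1 \<bullet> (axis i 1 :: real^'n) = 1"
      by (simp add: inner_axis)
    ultimately show "\<exists>x. p i = lin_comb p x \<and> 1 \<bullet> x = 1" by metis
  qed
  ultimately have "affine hull range p \<subseteq> ?A"
    by (rule hull_minimal[rotated])
  with assms that show ?thesis by blast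
qed

lemma lin_comb_translate: "lin_comb (\<lambda>i. p i - a) x = lin_comb p x - (1 \<bullet> x) *\<^sub>R a"
  by (simp add: lin_comb_def scaleR_diff_right sum_subtractf one_inner scaleR_sum_left)

text \<open>\<open>spherical_edm\<close> demands a centre inside the hull. The foot of the
  perpendicular from the origin is such a centre: by Pythagoras all points lie at squared distance 1
  minus its squared norm.\<close>

lemma unit_sphere_affine_hull_sphere:
  fixes p :: "'n::finite \<Rightarrow> 'a::euclidean_space"
  assumes "\<And>i. norm (p i) = 1"
  obtains a \<rho> where "a \<in> affine hull range p" "range p \<subseteq> sphere a \<rho>" "\<rho> \<le> 1"
proof -
  fix i0 :: 'n
  let ?T = "(\<lambda>x. - p i0 + x) ` range p"
  have hull: "affine hull range p = (\<lambda>x. p i0 + x) ` span ?T"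
    by (rule affine_hull_span_gen) (simp add: hull_inc)
  obtain y z where y: "y \<in> span ?T" and z: "\<And>w. w \<in> span ?T \<Longrightarrow> orthogonal z w"
    and yz: "- p i0 = y + z"
    using orthogonal_subspace_decomp_exists[of ?T "- p i0"] by metis
  \<comment> \<open>\<open>y\<close> is a direction of the hull, so \<open>a\<close> lies in the
    hull; it equals \<open>- z\<close>, so it is orthogonal to all directions.\<close>
  define a where "a = p i0 + y"
  have za: "z = - a"
    using yz by (simp add: a_def algebra_simps)
  have pyth: "(dist a (p i))\<^sup>2 = 1 - (norm a)\<^sup>2" for i
  proof -
    have "- p i0 + p i - y \<in> span ?T"
      by (intro span_diff[OF span_base y] imageI rangeI)
    from z[OF this] have "a \<bullet> (p i - a) = 0"
      by (simp add: za a_def orthogonal_def algebra_simps inner_diff_right inner_add_right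
          inner_add_left inner_diff_left)
    then have "a \<bullet> p i = a \<bullet> a" by (simp add: inner_diff_right)
    moreover have "p i \<bullet> p i = 1" using assms by (simp add: norm_eq_1)
    ultimately show ?thesis
      unfolding dist_norm power2_norm_eq_inner inner_diff_left inner_diff_right
      by (simp add: inner_commute[of "p i" a])
  qed
  have "dist a (p i) = sqrt (1 - (norm a)\<^sup>2)" for i
    by (metis pyth real_sqrt_unique zero_le_dist)
  then have "range p \<subseteq> sphere a (sqrt (1 - (norm a)\<^sup>2))" by auto
  moreover have "sqrt (1 - (norm a)\<^sup>2) \<le> 1" by simp
  moreover have "a \<in> affine hull range p" unfolding hull a_def using y by blast
  ultimately show ?thesis using that by blast
qed

lemma spherical_edm_le_1_iff:
  fixes D :: "real^'n^'n"
  assumes sym: "transpose D = D" and diag: "\<And>i. D $ i $ i = 0"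
  shows "(\<exists>\<rho>\<le>1. spherical_edm D \<rho>) \<longleftrightarrow> (\<forall>x. x \<bullet> (D *v x) \<le> 2 * (1 \<bullet> x)\<^sup>2)"
proof
  assume "\<exists>\<rho>\<le>1. spherical_edm D \<rho>"
  then obtain \<rho> a and p :: "'n \<Rightarrow> real^'n"
    where "\<rho> \<le> 1" and p: "generating_points D p" and "range p \<subseteq> sphere a \<rho>"
    unfolding spherical_edm_def by blast
  then have norm: "norm (p i - a) = \<rho>" for i
    by (metis dist_commute dist_norm mem_sphere range_subsetD)
  \<comment> \<open>\<open>\<rho>\<close> is a norm, hence nonnegative, so the bound passes to its
    square.\<close>
  then have "\<rho>\<^sup>2 \<le> 1"
    by (metis \<open>\<rho> \<le> 1\<close> norm_ge_zero power_le_one)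
  show "\<forall>x. x \<bullet> (D *v x) \<le> 2 * (1 \<bullet> x)\<^sup>2"
  proof
    fix x
    let ?y = "lin_comb (\<lambda>i. p i - a) x"
    have "x \<bullet> (D *v x) = 2 * (\<rho>\<^sup>2 * (1 \<bullet> x)\<^sup>2) - 2 * (?y \<bullet> ?y)"
      using inner_edm_mult_sphere[of D "\<lambda>i. p i - a" \<rho> x x] norm p
      by (simp add: generating_points_translate power2_eq_square)
    also have "\<dots> \<le> 2 * (1 * (1 \<bullet> x)\<^sup>2) - 2 * 0"
      using \<open>\<rho>\<^sup>2 \<le> 1\<close> by (intro diff_mono mult_left_mono mult_right_mono) auto
    finally show "x \<bullet> (D *v x) \<le> 2 * (1 \<bullet> x)\<^sup>2" by simp
  qed
next
  assume *: "\<forall>x. x \<bullet> (D *v x) \<le> 2 * (1 \<bullet> x)\<^sup>2"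
  define M where "M = (\<chi> i j. 1 - D $ i $ j / 2)"
  have Dsym: "D $ i $ j = D $ j $ i" for i j
    by (rule symmetric_matrix_component[OF sym])
  have "transpose M = M"
    unfolding M_def transpose_def vec_eq_iff vec_lambda_beta by (metis Dsym)
  moreover have "0 \<le> x \<bullet> (M *v x)" for x
  proof -
    have "x \<bullet> (M *v x) = (1 \<bullet> x)\<^sup>2 - x \<bullet> (D *v x) / 2"
      unfolding inner_mult_vec one_inner power2_eq_square sum_product sum_divide_distrib
        sum_subtractf[symmetric]
      by (intro sum.cong refl) (simp add: M_def algebra_simps)
    with *[rule_format, of x] show ?thesis by linarith
  qed
  ultimately obtain p :: "'n \<Rightarrow> real^'n" where p: "\<And>i j. M $ i $ j = p i \<bullet> p j"
    by (metis psd_gram)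
  have "p i \<bullet> p i = 1" for i
    by (simp add: M_def diag flip: p)
  then have norm: "norm (p i) = 1" for i
    by (simp add: norm_eq_1)
  have "D $ i $ j = (norm (p i - p j))\<^sup>2" for i j
    unfolding power2_norm_eq_inner inner_diff_left inner_diff_right p[symmetric]
    by (simp add: M_def diag Dsym[of j i])
  then have "generating_points D p" by (simp add: generating_points_def)
  with norm show "\<exists>\<rho>\<le>1. spherical_edm D \<rho>"
    unfolding spherical_edm_def by (metis unit_sphere_affine_hull_sphere)
qed

section \<open>The quadratic form of the perturbed matrix\<close>

lemma inner_E_matrix:
  fixes x y :: "real^'n"
  assumes "k \<noteq> l"
  shows "x \<bullet> (E_matrix k l *v y) = x $ k * y $ l + x $ l * y $ k"
proof -
  have "E_matrix k l *v y = y $ l *\<^sub>R axis k 1 + y $ k *\<^sub>R axis l 1"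
    using assms
    by (auto simp: E_matrix_def vec_eq_iff matrix_vector_mult_def axis_def
        if_distrib[of "\<lambda>c. c * _"] cong: if_cong)
  then show ?thesis by (simp add: inner_add_right inner_axis)
qed

lemma T_le_iff:
  fixes D :: "real^'n^'n"
  assumes "generating_points D p" and "k \<noteq> l"
  shows "t \<in> T_le D k l \<longleftrightarrow> (\<forall>x. x \<bullet> (D *v x) + 2 * t * (x $ k * x $ l) \<le> 2 * (1 \<bullet> x)\<^sup>2)"
proof -
  let ?D = "D + t *\<^sub>R E_matrix k l"
  have "transpose ?D = ?D"
    using assms
    by (auto simp: vec_eq_iff transpose_def generating_points_def E_matrix_def norm_minus_commute)
  moreover have "?D $ i $ i = 0" for i
    using assms by (auto simp: generating_points_def E_matrix_def)
  moreover have "x \<bullet> (?D *v x) = x \<bullet> (D *v x) + 2 * t * (x $ k * x $ l)" for x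
    by (simp add: matrix_vector_mult_add_rdistrib inner_add_right inner_E_matrix[OF assms(2)]
        flip: scaleR_matrix_vector_assoc)
  ultimately show ?thesis
    unfolding T_le_def by (simp add: spherical_edm_le_1_iff)
qed

section \<open>Perturbing a pair of distances\<close>

text \<open>With \<open>v = e\<^sub>k - c e\<^sub>l\<close>, the form \<open>x\<^sub>k x\<^sub>l\<close> equals \<open>c x\<^sub>l\<^sup>2 + x\<^sub>l (v \<bullet> x)\<close>; the null vector
  \<open>z\<close> lets \<open>x\<^sub>l\<close> vary freely while \<open>v \<bullet> x\<close> is controlled by Cauchy--Schwarz, so that only a
  binary quadratic form has to be examined.\<close>
lemma psd_perturbation_iff:
  fixes u :: "'n::finite \<Rightarrow> 'a::real_inner"
  assumes y: "\<And>x. lin_comb u y \<bullet> lin_comb u x = x $ k - c * x $ l"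
    and z: "lin_comb u z = 0" "z $ l \<noteq> 0"
    and m: "m = lin_comb u y \<bullet> lin_comb u y" "0 < m"
  shows "(\<forall>x. t * (x $ k * x $ l) \<le> lin_comb u x \<bullet> lin_comb u x) \<longleftrightarrow> t\<^sup>2 * m \<le> - 4 * t * c"
proof
  assume *: "\<forall>x. t * (x $ k * x $ l) \<le> lin_comb u x \<bullet> lin_comb u x"
  \<comment> \<open>The multiple of \<open>z\<close> normalises \<open>x $ l\<close> to 1 without
    changing the Gram form. Along \<open>y\<close> the coefficient \<open>t / 2\<close> minimises
    the difference of the two sides, so this is the sharpest test vector.\<close>
  define x where "x = (t / 2) *\<^sub>R y + ((1 - t / 2 * y $ l) / z $ l) *\<^sub>R z"
  have ux: "lin_comb u x = (t / 2) *\<^sub>R lin_comb u y"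
    by (simp add: x_def lin_comb_add lin_comb_scaleR z)
  have xl: "x $ l = 1"
    using z(2) by (simp add: x_def)
  have "t / 2 * m = x $ k - c"
    using y[of x] by (simp add: ux xl flip: m(1))
  then have xk: "x $ k = t / 2 * m + c" by linarith
  have "t * (t / 2 * m + c) \<le> (t / 2)\<^sup>2 * m"
    using *[rule_format, of x] by (simp add: ux xl xk power2_eq_square flip: m(1))
  then show "t\<^sup>2 * m \<le> - 4 * t * c"
    by (simp add: power2_eq_square field_simps)
next
  assume t: "t\<^sup>2 * m \<le> - 4 * t * c"
  show "\<forall>x. t * (x $ k * x $ l) \<le> lin_comb u x \<bullet> lin_comb u x"
  proof
    fix x
    define b where "b = x $ k - c * x $ l"
    define s where "s = x $ l"
    define q where "q = lin_comb u x \<bullet> lin_comb u x"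
    have cs: "b\<^sup>2 \<le> m * q"
      using Cauchy_Schwarz_ineq[of "lin_comb u y" "lin_comb u x"] by (simp add: b_def y q_def m(1))
    \<comment> \<open>Here \<open>x $ k * x $ l\<close> is \<open>s * b + c * s\<^sup>2\<close>. The
      hypothesis bounds \<open>t * c\<close> by \<open>- t\<^sup>2 * m / 4\<close>, which is what
      completes the square.\<close>
    have "m * (t * (s * b + c * s\<^sup>2)) \<le> m * t * s * b - m * (t\<^sup>2 * m) / 4 * s\<^sup>2"
      using mult_left_mono[OF t, of "m * s\<^sup>2"] m(2) by (simp add: algebra_simps)
    also have "\<dots> = b\<^sup>2 - (b - m * t * s / 2)\<^sup>2"
      by (simp add: power2_eq_square algebra_simps)
    also have "\<dots> \<le> b\<^sup>2" by simp
    also note cs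
    finally have "t * (s * b + c * s\<^sup>2) \<le> q"
      using m(2) by (simp only: mult_le_cancel_left_pos)
    then show "t * (x $ k * x $ l) \<le> q"
      by (simp add: s_def b_def power2_eq_square algebra_simps)
  qed
qed

text \<open>The condition reads \<open>t * (t * m + 4 * c) \<le> 0\<close>, with roots 0 and
  \<open>- 4 * c / m\<close>; the sign of \<open>c\<close> orders them.\<close>

lemma quadratic_le_linear_interval:
  fixes m c :: real
  assumes "0 < m"
  shows "0 < c \<Longrightarrow> {t. t\<^sup>2 * m \<le> - 4 * t * c} = {- 4 * c / m..0}"
    and "c < 0 \<Longrightarrow> {t. t\<^sup>2 * m \<le> - 4 * t * c} = {0..- 4 * c / m}"
proof -
  have eq: "t\<^sup>2 * m \<le> - 4 * t * c \<longleftrightarrow> t * (t * m + 4 * c) \<le> 0" for t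
  proof -
    have "t\<^sup>2 * m - - 4 * t * c = t * (t * m + 4 * c)"
      by (simp add: power2_eq_square algebra_simps)
    then show ?thesis by linarith
  qed
  have "- 4 * c / m \<le> t \<longleftrightarrow> 0 \<le> t * m + 4 * c" "t \<le> - 4 * c / m \<longleftrightarrow> t * m + 4 * c \<le> 0" for t
    using assms by (auto simp: field_simps)
  note iff = this
  show "{t. t\<^sup>2 * m \<le> - 4 * t * c} = {- 4 * c / m..0}" if "0 < c"
  proof (rule set_eqI)
    fix t
    \<comment> \<open>Excludes the sign pattern in which \<open>t\<close> is nonnegative and the
      other factor nonpositive.\<close>
    have "0 < t * m + 4 * c" if "0 \<le> t"
      using \<open>0 < c\<close> assms that by (simp add: add_nonneg_pos)
    then show "t \<in> {t. t\<^sup>2 * m \<le> - 4 * t * c} \<longleftrightarrow> t \<in> {- 4 * c / m..0}"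
      unfolding mem_Collect_eq eq atLeastAtMost_iff iff mult_le_0_iff by fastforce
  qed
  show "{t. t\<^sup>2 * m \<le> - 4 * t * c} = {0..- 4 * c / m}" if "c < 0"
  proof (rule set_eqI)
    fix t
    have "t * m + 4 * c < 0" if "t \<le> 0"
      using \<open>c < 0\<close> assms that by (simp add: add_nonpos_neg mult_nonpos_nonneg)
    then show "t \<in> {t. t\<^sup>2 * m \<le> - 4 * t * c} \<longleftrightarrow> t \<in> {0..- 4 * c / m}"
      unfolding mem_Collect_eq eq atLeastAtMost_iff iff mult_le_0_iff by fastforce
  qed
qed

section \<open>The centred Gram matrix and Gale matrices\<close>

lemma centering_matrix_mult: "centering_matrix *v x = x - ((1 \<bullet> x) / real CARD('n)) *\<^sub>R 1"
  for x :: "real^'n"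
proof -
  have "(\<chi> i j. 1 :: real^'n^'n) *v x = (1 \<bullet> x) *\<^sub>R 1"
    by (simp add: vec_eq_iff matrix_vector_mult_def one_inner)
  then show ?thesis
    by (simp add: centering_matrix_def matrix_vector_mult_diff_rdistrib
        flip: scaleR_matrix_vector_assoc)
qed

lemma transpose_centering_matrix: "transpose centering_matrix = centering_matrix"
  by (simp add: centering_matrix_def transpose_def mat_def vec_eq_iff eq_commute)

lemma inner_one_one: "(1 :: real^'n) \<bullet> 1 = real CARD('n)"
  by (simp add: one_inner)

context
  fixes P :: "real^'r^'n" and D :: "real^'n^'n"
  assumes P: "P ** transpose P = - (1/2) *\<^sub>R (centering_matrix ** D ** centering_matrix)"
begin

lemma inner_factor:
  "(transpose P *v x) \<bullet> (transpose P *v y)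
    = - (1/2) * ((centering_matrix *v x) \<bullet> (D *v (centering_matrix *v y)))"
proof -
  have "(transpose P *v x) \<bullet> (transpose P *v y) = x \<bullet> ((P ** transpose P) *v y)"
    by (simp only: inner_mult_transpose matrix_vector_mul_assoc[symmetric])
  also have "\<dots> = - (1/2) * (x \<bullet> (centering_matrix *v (D *v (centering_matrix *v y))))"
    by (simp only: P scaleR_matrix_vector_assoc[symmetric] inner_scaleR_right
        matrix_vector_mul_assoc matrix_mul_assoc)
  finally show ?thesis
    by (simp only: inner_mult_transpose[of x centering_matrix] transpose_centering_matrix)
qed

text \<open>Centring annihilates the all-ones vector, so its image has norm 0: the rows of
  \<open>P\<close> have their centroid at the origin.\<close>

lemma factor_one: "transpose P *v 1 = 0"
proof -
  have "centering_matrix *v (1 :: real^'n) = 0"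
    by (simp add: centering_matrix_mult inner_one_one)
  then have "(transpose P *v 1) \<bullet> (transpose P *v 1) = 0"
    by (simp add: inner_factor del: transpose_matrix_vector)
  then show ?thesis by simp
qed

text \<open>Centring fixes \<open>x\<close> and \<open>y\<close>. On such vectors \<open>D\<close>
  alone thus determines the Gram form, which allows \<open>P\<close> to be compared with other
  configurations.\<close>

lemma inner_factor_centered:
  assumes "1 \<bullet> x = 0" "1 \<bullet> y = 0"
  shows "x \<bullet> (D *v y) = - 2 * ((transpose P *v x) \<bullet> (transpose P *v y))"
  by (simp add: inner_factor centering_matrix_mult assms del: transpose_matrix_vector)

end

section \<open>Consequences of full column rank\<close>

lemma transpose_mult_eq_0_iff:
  fixes P :: "real^'r^'n"
  shows "transpose P *v x = 0 \<longleftrightarrow> (\<forall>v. x \<bullet> (P *v v) = 0)"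
  by (metis inner_eq_zero_iff inner_mult_transpose inner_zero_left)

text \<open>The kernel of \<open>transpose P\<close> is orthogonal to the
  \<open>CARD('r)\<close>-dimensional range of \<open>P\<close>, which bounds its independent sets.
  The set \<open>{1}\<close> leaves only the cases \<open>r = n - 1\<close> and
  \<open>r \<le> n - 2\<close>; \<open>{1, x}\<close> shows that the Gale space is trivial in the
  first.\<close>

lemma full_rank_orthogonal_complement:
  fixes P :: "real^'r^'n"
  assumes rank: "rank P = CARD('r)" and one: "transpose P *v 1 = 0"
  shows "CARD('r) + 1 \<le> CARD('n)"
    and "\<lbrakk>CARD('r) + 1 = CARD('n); transpose P *v x = 0; 1 \<bullet> x = 0\<rbrakk> \<Longrightarrow> x = 0"
proof -
  have bound: "CARD('r) + card B \<le> CARD('n)"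
    if "independent B" "\<And>b. b \<in> B \<Longrightarrow> transpose P *v b = 0" for B :: "(real^'n) set"
  proof -
    have "dim (range ((*v) P) \<union> B) = dim (range ((*v) P)) + dim B"
      by (rule dim_orthogonal_sum) (use that(2) in \<open>auto simp only: transpose_mult_eq_0_iff inner_commute[of "P *v _"]\<close>)
    also have "\<dots> = CARD('r) + card B"
      using rank that(1) by (simp add: rank_dim_range dim_eq_card_independent)
    finally show ?thesis
      using dim_subset_UNIV_cart[of "range ((*v) P) \<union> B"] by simp
  qed
  have one_neq: "(1 :: real^'n) \<noteq> 0" by (simp add: vec_eq_iff)
  show "CARD('r) + 1 \<le> CARD('n)"
    using bound[of "{1}"] one one_neq by (simp del: transpose_matrix_vector)
  show "x = 0" if "CARD('r) + 1 = CARD('n)" "transpose P *v x = 0" "1 \<bullet> x = 0"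
  proof (rule ccontr)
    assume "x \<noteq> 0"
    have "x \<noteq> 1" using that(3) inner_one_one[where 'n = 'n] by force
    moreover have "independent {1, x}"
      using that(3) one_neq \<open>x \<noteq> 0\<close>
      by (intro pairwise_orthogonal_independent)
        (auto simp: pairwise_insert orthogonal_def inner_commute[of x])
    moreover have "transpose P *v b = 0" if "b \<in> {1, x}" for b
      using that one \<open>transpose P *v x = 0\<close> by blast
    ultimately have "CARD('r) + card {1, x} \<le> CARD('n)"
      by (intro bound)
    then show False
      using \<open>x \<noteq> 1\<close> \<open>CARD('r) + 1 = CARD('n)\<close> by simp
  qed
qed

lemma lin_comb_rows: "lin_comb (\<lambda>i. Q $ i) x = transpose Q *v x"
  for Q :: "real^'r^'n"
  by (simp add: lin_comb_def vec_eq_iff matrix_vector_mult_def transpose_def mult.commute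
      del: transpose_matrix_vector)

lemma transpose_mult_axis: "transpose S *v axis k 1 = S $ k"
  for S :: "real^'r^'n"
  by (simp add: matrix_vector_mult_basis column_def transpose_def vec_eq_iff
      del: transpose_matrix_vector)

lemma invertible_gram:
  fixes P :: "real^'r^'n"
  assumes "rank P = CARD('r)"
  shows "invertible (transpose P ** P)"
proof -
  have "x = 0" if "(transpose P ** P) *v x = 0" for x
  proof -
    have "P *v x = 0"
      by (rule gram_eq_0_imp_eq_0) (simp only: matrix_vector_mul_assoc that)
    moreover have "inj ((*v) P)"
      using assms by (simp only: full_rank_injective)
    ultimately show "x = 0"
      by (metis injD matrix_vector_mult_0_right)
  qed
  then show ?thesis
    by (simp only: invertible_left_inverse matrix_left_invertible_ker) blast
qed

text \<open>\<open>P S\<^sup>T\<close> is the orthogonal projection onto the range of \<open>P\<close>.\<close>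
lemma pseudo_inverse_factor:
  fixes P S :: "real^'r^'n"
  assumes "rank P = CARD('r)" and S: "S = P ** matrix_inv (transpose P ** P)"
  shows "transpose P ** S = mat 1" and "transpose P ** P ** transpose S = transpose P"
proof -
  let ?K = "transpose P ** P"
  have inv: "?K ** matrix_inv ?K = mat 1" "matrix_inv ?K ** ?K = mat 1"
    using someI_ex[OF invertible_gram[OF assms(1), unfolded invertible_def]]
    by (simp_all only: matrix_inv_def)
  show "transpose P ** S = mat 1"
    by (simp only: S matrix_mul_assoc inv)
  \<comment> \<open>\<open>?K\<close> is symmetric, so transposing its left inverse yields a right
    inverse.\<close>
  have "?K ** transpose (matrix_inv ?K) = transpose (matrix_inv ?K ** ?K)"
    by (simp only: matrix_transpose_mul transpose_transpose)
  also have "\<dots> = mat 1"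
    by (simp only: inv transpose_mat)
  finally show "?K ** transpose S = transpose P"
    by (simp only: S matrix_transpose_mul matrix_mul_assoc matrix_mul_lid)
qed

text \<open>Three configurations of \<open>D\<close> meet here: \<open>u\<close> on the unit sphere,
  \<open>Q\<close> behind the Gale matrix and \<open>P\<close> behind \<open>S\<close>. They share
  one Gram form on centred vectors, so null vectors transfer between them.\<close>

lemma T_le_parallel_rows:
  fixes D :: "real^'n^'n"
    and P Q S :: "real^'r^'n"
    and Z Zt :: "(real^'n) list"
  assumes D: "spherical_edm D 1" and kl: "k \<noteq> l"
    and w: "w = moore_penrose D *v 1"
    and gale: "CARD('r) + 2 \<le> CARD('n) \<Longrightarrow> gale_matrix D Q Z"
    and Zt: "Zt = (if CARD('r) + 1 = CARD('n) then [w] else w # Z)"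
    and P: "P ** transpose P = - (1/2) *\<^sub>R (centering_matrix ** D ** centering_matrix)"
    and rank: "rank P = CARD('r)"
    and S_eq: "S = P ** matrix_inv (transpose P ** P)"
    and rows: "col_list_row Zt k = map (\<lambda>x. c * x) (col_list_row Zt l)"
    and row_nonzero: "\<exists>x \<in> set (col_list_row Zt k). x \<noteq> 0"
  shows "0 < (norm (S $ k - c *\<^sub>R S $ l))\<^sup>2"
    and "T_le D k l = {t. t\<^sup>2 * (norm (S $ k - c *\<^sub>R S $ l))\<^sup>2 \<le> - 4 * t * c}"
proof -
  note [simp del] = transpose_matrix_vector
  obtain p :: "'n \<Rightarrow> real^'n" and a where p: "generating_points D p"
    and a: "a \<in> affine hull range p" and sphere: "range p \<subseteq> sphere a 1"
    using D unfolding spherical_edm_def by blast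
  \<comment> \<open>Moving the centre to the origin makes \<open>D\<close> twice the all-ones matrix
    minus twice the Gram matrix of \<open>u\<close>.\<close>
  define u where "u = (\<lambda>i. p i - a)"
  have u: "generating_points D u"
    unfolding u_def using p by (simp only: generating_points_translate)
  have "norm (u i) = 1" for i
    using sphere unfolding u_def by (metis dist_commute dist_norm mem_sphere range_subsetD)
  note D_form = inner_edm_mult_sphere[OF u this]
  obtain x0 where x0: "1 \<bullet> x0 = 1" "lin_comb p x0 = a"
    using affine_hull_range_lin_comb[OF a] by metis
  then have ux0: "lin_comb u x0 = 0"
    by (simp add: u_def lin_comb_translate)
  \<comment> \<open>The barycentric coordinates \<open>x0\<close> of the centre are a null vector of
    \<open>u\<close>, so \<open>D\<close> maps their half to the all-ones vector.\<close>
  have "y \<bullet> (D *v ((1/2) *\<^sub>R x0)) = y \<bullet> 1" for y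
    by (simp add: D_form x0 lin_comb_scaleR ux0 inner_commute)
  then have Dx0: "D *v ((1/2) *\<^sub>R x0) = 1"
    by (metis vector_eq_ldot)
  then have Dw: "D *v w = 1"
    using moore_penrose_solves[OF Dx0] w by simp
  have w1: "1 \<bullet> w = 1 / 2"
  proof -
    have "1 \<bullet> x0 = 2 * (1 \<bullet> x0) * (1 \<bullet> w)"
      using D_form[of x0 w] by (simp add: Dw ux0 inner_commute)
    then show ?thesis by (simp add: x0)
  qed
  \<comment> \<open>Both \<open>w \<bullet> (D *v w)\<close> and the all-ones part of its expansion
    equal 1/2, leaving 0 for the Gram part.\<close>
  have uw: "lin_comb u w = 0"
  proof -
    have "1 \<bullet> w = 2 * (1 \<bullet> w) * (1 \<bullet> w) - 2 * (lin_comb u w \<bullet> lin_comb u w)"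
      using D_form[of w w] by (simp add: Dw inner_commute)
    then show ?thesis by (simp add: w1)
  qed
  note P1 = factor_one[OF P]
    and PP = inner_factor_centered[OF P]
    and rank_P = full_rank_orthogonal_complement[OF rank factor_one[OF P]]
  have Z: "span (set Z) = {x. transpose Q *v x = 0 \<and> 1 \<bullet> x = 0}" "generating_points D (\<lambda>i. Q $ i)"
    if "CARD('r) + 1 \<noteq> CARD('n)"
    using gale rank_P(1) that by (auto simp: gale_matrix_def)
  have centered_forms: "lin_comb u x \<bullet> lin_comb u y = (transpose P *v x) \<bullet> (transpose P *v y)"
    if "1 \<bullet> x = 0" "1 \<bullet> y = 0" for x y
    using PP[OF that] D_form[of x y] that by simp
  have Zt_null: "lin_comb u z = 0" if "z \<in> set Zt" for z
  proof (cases "z = w")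
    case False
    then have n: "CARD('r) + 1 \<noteq> CARD('n)" "z \<in> set Z"
      using that Zt by (auto split: if_splits)
    then have "transpose Q *v z = 0" "1 \<bullet> z = 0"
      using Z(1) span_base[of z "set Z"] by auto
    then have "lin_comb u z \<bullet> lin_comb u z = 0"
      using inner_edm_mult_centered[OF Z(2), of z z] D_form[of z z] n(1) by (simp add: lin_comb_rows)
    then show ?thesis by simp
  qed (simp add: uw)
  define v :: "real^'n" where "v = axis k 1 - c *\<^sub>R axis l 1"
  have v_inner: "v \<bullet> x = x $ k - c * x $ l" for x
    by (simp add: v_def inner_diff_left inner_axis')
  have "z $ k = c * z $ l" if "z \<in> set Zt" for z
    using rows that by (simp add: col_list_row_def comp_def)
  then have v_Zt: "v \<bullet> z = 0" if "z \<in> set Zt" for z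
    using that by (simp add: v_inner)
  \<comment> \<open>The Gale space of \<open>P\<close> is trivial or, through the vanishing form of
    \<open>D\<close>, contained in that of \<open>Q\<close>, whose basis \<open>v\<close>
    annihilates.\<close>
  have v_gale: "v \<bullet> x = 0" if "transpose P *v x = 0" "1 \<bullet> x = 0" for x
  proof (cases "CARD('r) + 1 = CARD('n)")
    case True
    have "x = 0" by (rule rank_P(2)[OF True that])
    then show ?thesis by simp
  next
    case False
    have "x \<bullet> (D *v x) = 0"
      by (simp add: PP that)
    then have "transpose Q *v x = 0"
      using inner_edm_mult_centered[OF Z(2)[OF False], of x x] that by (simp add: lin_comb_rows)
    then have "x \<in> span (set Z)"
      using Z(1)[OF False] that by simp
    moreover have "set Z \<subseteq> {x. v \<bullet> x = 0}"
      using v_Zt Zt False by auto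
    then have "span (set Z) \<subseteq> {x. v \<bullet> x = 0}"
      by (rule span_minimal) (rule subspace_hyperplane)
    ultimately show ?thesis by blast
  qed
  note S = pseudo_inverse_factor[OF rank S_eq]
  define h where "h = transpose S *v v"
  \<comment> \<open>As \<open>transpose P ** S\<close> is the identity, \<open>y\<close> is a
    centred preimage of \<open>h\<close> under \<open>transpose P\<close>.\<close>
  define y where "y = S *v h"
  have Py: "transpose P *v y = h"
    by (simp add: y_def matrix_vector_mul_assoc S)
  have y1: "1 \<bullet> y = 0"
    by (simp add: y_def S_eq inner_mult_transpose P1 flip: matrix_vector_mul_assoc)
  text \<open>\<open>g\<close> is the component of \<open>v\<close> in the Gale space; it vanishes because \<open>v\<close> is orthogonal
    to that space.\<close>
  define g where "g = v - P *v h - ((1 \<bullet> v) / real CARD('n)) *\<^sub>R 1"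
  have "transpose P *v (P *v h) = transpose P *v v"
    unfolding h_def by (simp only: matrix_vector_mul_assoc matrix_mul_assoc S)
  then have Pg: "transpose P *v g = 0"
    by (simp add: g_def matrix_vector_mult_diff_distrib matrix_vector_mult_scaleR P1)
  have "1 \<bullet> (P *v h) = 0"
    by (simp add: inner_mult_transpose P1)
  then have g1: "1 \<bullet> g = 0"
    by (simp add: g_def inner_diff_right inner_one_one)
  have "g \<bullet> (P *v h) = 0"
    by (simp add: inner_mult_transpose Pg)
  moreover have "g \<bullet> g = g \<bullet> v - g \<bullet> (P *v h) - ((1 \<bullet> v) / real CARD('n)) * (g \<bullet> 1)"
    by (subst (2) g_def) (simp add: inner_diff_right)
  ultimately have "g \<bullet> g = 0"
    using v_gale[OF Pg g1] g1 by (simp add: inner_commute[of g v] inner_commute[of g 1])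
  then have "g = 0" by simp
  then have v_eq: "v = P *v h + ((1 \<bullet> v) / real CARD('n)) *\<^sub>R 1"
    unfolding g_def by (simp add: algebra_simps)
  have uy: "lin_comb u y \<bullet> lin_comb u x = v \<bullet> x" for x
  proof -
    \<comment> \<open>Since the entries of \<open>w\<close> sum to 1/2, this shift centres
      \<open>x\<close>. It changes neither side, because \<open>w\<close> is null for
      \<open>u\<close> and orthogonal to \<open>v\<close>; the all-ones part of \<open>v\<close>
      does not see \<open>x'\<close>.\<close>
    define x' where "x' = x + (- 2 * (1 \<bullet> x)) *\<^sub>R w"
    have x'1: "1 \<bullet> x' = 0"
      by (simp add: x'_def inner_diff_right w1)
    have "lin_comb u y \<bullet> lin_comb u x = lin_comb u y \<bullet> lin_comb u x'"
      by (simp only: x'_def lin_comb_add lin_comb_scaleR uw) simp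
    also have "\<dots> = (P *v h) \<bullet> x'"
      by (simp add: centered_forms[OF y1 x'1] Py inner_transpose_mult)
    also have "\<dots> = v \<bullet> x'"
      by (subst v_eq) (simp add: inner_add_left x'1)
    also have "\<dots> = v \<bullet> x"
      using v_Zt[of w] Zt by (simp add: x'_def inner_diff_right)
    finally show ?thesis .
  qed
  have m: "(norm (S $ k - c *\<^sub>R S $ l))\<^sup>2 = lin_comb u y \<bullet> lin_comb u y"
  proof -
    have "h = S $ k - c *\<^sub>R S $ l"
      by (simp add: h_def v_def matrix_vector_mult_diff_distrib matrix_vector_mult_scaleR
          transpose_mult_axis)
    moreover have "v \<bullet> y = h \<bullet> h"
      by (simp add: y_def inner_mult_transpose h_def)
    ultimately show ?thesis
      by (simp add: uy power2_norm_eq_inner)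
  qed
  \<comment> \<open>If \<open>lin_comb u y\<close> vanished, \<open>uy\<close> would give
    \<open>v \<bullet> v = 0\<close>; the entry at \<open>k\<close> prevents this because
    \<open>k\<close> and \<open>l\<close> differ.\<close>
  have "v $ k = 1"
    using kl by (simp add: v_def axis_def)
  then have "v \<bullet> v \<noteq> 0"
    by auto
  then have "lin_comb u y \<noteq> 0"
    using uy[of v] by auto
  then show m_pos: "0 < (norm (S $ k - c *\<^sub>R S $ l))\<^sup>2"
    by (simp add: m)
  \<comment> \<open>Orthogonality to \<open>v\<close> gives \<open>z $ k = c * z $ l\<close>, so a
    nonzero entry at \<open>k\<close> forces one at \<open>l\<close>.\<close>
  obtain z where "z \<in> set Zt" "z $ k \<noteq> 0"
    using row_nonzero by (auto simp: col_list_row_def)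
  then have z: "lin_comb u z = 0" "z $ l \<noteq> 0"
    using Zt_null v_Zt[of z] by (auto simp: v_inner)
  show "T_le D k l = {t. t\<^sup>2 * (norm (S $ k - c *\<^sub>R S $ l))\<^sup>2 \<le> - 4 * t * c}"
  proof (rule set_eqI)
    fix t
    have "t \<in> T_le D k l \<longleftrightarrow> (\<forall>x. t * (x $ k * x $ l) \<le> lin_comb u x \<bullet> lin_comb u x)"
      using kl by (simp add: T_le_iff[OF u] D_form power2_eq_square)
    also have "\<dots> \<longleftrightarrow> t\<^sup>2 * (norm (S $ k - c *\<^sub>R S $ l))\<^sup>2 \<le> - 4 * t * c"
      by (rule psd_perturbation_iff[OF _ z m m_pos]) (simp add: uy v_inner)
    finally show "t \<in> T_le D k l \<longleftrightarrow> t \<in> {t. t\<^sup>2 * (norm (S $ k - c *\<^sub>R S $ l))\<^sup>2 \<le> - 4 * t * c}"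
      by simp
  qed
qed

theorem theorem3p3:
  fixes D :: "real^'n::{finite,linorder}^'n::_"
    and P Q :: "real^'r^'n::_"
    and S :: "real^'r^'n::_"
    and Z Zt :: "(real^'n::_) list"
    and w :: "real^'n::_"
    and k l :: 'n
    and c \<theta> :: real
  assumes "spherical_edm D 1"
    and "embedding_dim D = CARD('r)"
    and "k < l"
    and "w = moore_penrose D *v vec 1"
    and "CARD('r) + 2 \<le> CARD('n) \<Longrightarrow> gale_matrix D Q Z"
    and "Zt = (if CARD('r) + 1 = CARD('n) then [w] else w # Z)"
    and "P ** transpose P = - (1/2) *\<^sub>R (centering_matrix ** D ** centering_matrix)"
    and "rank P = CARD('r)"
    and "S = P ** matrix_inv (transpose P ** P)"
    and "c \<noteq> 0"
    and "col_list_row Zt k = map (\<lambda>x. c * x) (col_list_row Zt l)"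
    and "\<exists>x \<in> set (col_list_row Zt k). x \<noteq> 0"
    and "\<theta> = - 4 * c / (norm (S $ k - c *\<^sub>R S $ l))\<^sup>2"
  shows "(c > 0 \<longrightarrow> T_le D k l = {\<theta>..0}) \<and> (c < 0 \<longrightarrow> T_le D k l = {0..\<theta>})"
proof -
  have "k \<noteq> l" using \<open>k < l\<close> by simp
  note T = T_le_parallel_rows[OF assms(1) \<open>k \<noteq> l\<close> assms(4)[unfolded vec_1] assms(5-9,11,12)]
  show ?thesis
    using quadratic_le_linear_interval[OF T(1)] T(2) assms(13) by simp
qed

end
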